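(* Let $K$ be a convex body in $\mathbb{R}^d$. If we define $\delta(A) = R(A,K)$ for all finite $A \subseteq \mathbb{R}^d$, then $(\mathbb{R}^d,\delta)$ is a diversity.
   Context: A convex body in $\mathbb{R}^d$ is a compact, convex set with non-empty interior. For a convex body $K$ in $\mathbb{R}^d$ and bounded $A \subseteq \mathbb{R}^d$, the generalized circumradius of $A$ with respect to $K$ is \[R(A,K) = \inf\{\lambda \ge 0 : A \subseteq \lambda K+x \mbox{ for some } x \in \mathbb{R}^d\}.\] A diversity is a pair $(X,\delta)$ where $X$ is a set and $\delta$ is a function from the finite subsets of $X$ to $\mathbb{R}_{\geq 0}$ such that, for all finite $A,B,C \subseteq X$: (D1) $\delta(A)=0$ if and only if $|A| \leq 1$; (D2) if $B \neq \emptyset$ then $\delta(A \cup C) \leq \delta(A \cup B) + \delta(B \cup C)$. *)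

theory Defs
  imports "HOL-Analysis.Analysis"
begin

definition convex_body :: "'a::euclidean_space set \<Rightarrow> bool" where
  "convex_body K \<longleftrightarrow> compact K \<and> convex K \<and> interior K \<noteq> {}"

(* Meaningful for a convex body K and bounded A: the set under the infimum is then nonempty. *)
definition circumradius :: "'a::euclidean_space set \<Rightarrow> 'a set \<Rightarrow> real" where
  "circumradius A K = Inf {r. r \<ge> 0 \<and> (\<exists>x. A \<subseteq> (\<lambda>k. r *\<^sub>R k + x) ` K)}"

(* delta is a function on the finite subsets of X; its values elsewhere are unconstrained. *)
definition diversity :: "'a set \<Rightarrow> ('a set \<Rightarrow> real) \<Rightarrow> bool" where
  "diversity X \<delta> \<longleftrightarrow>
     (\<forall>A. finite A \<and> A \<subseteq> X \<longrightarrow> \<delta> A \<ge> 0) \<and>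
     (\<forall>A. finite A \<and> A \<subseteq> X \<longrightarrow> (\<delta> A = 0 \<longleftrightarrow> card A \<le> 1)) \<and>
     (\<forall>A B C. finite A \<and> finite B \<and> finite C \<and> A \<subseteq> X \<and> B \<subseteq> X \<and> C \<subseteq> X \<and> B \<noteq> {}
        \<longrightarrow> \<delta> (A \<union> C) \<le> \<delta> (A \<union> B) + \<delta> (B \<union> C))"

end

(* If rK + x contains A and B, sK + y contains B and C, and b lies in B, then b = r k + x = s l + y
   with k, l in K. By convexity both A and C lie in (r + s)K + (b - r k - s l), which gives the
   triangle inequality after passing to infima. *)

theory Submission
  imports Defs
begin

definition covering_scales :: "'a::euclidean_space set \<Rightarrow> 'a set \<Rightarrow> real set" where
  "covering_scales A K = {r. r \<ge> 0 \<and> (\<exists>x. A \<subseteq> (\<lambda>k. r *\<^sub>R k + x) ` K)}"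

lemma circumradius_eq_Inf: "circumradius A K = Inf (covering_scales A K)"
  by (simp add: circumradius_def covering_scales_def)

lemma covering_scales_nonneg: "r \<in> covering_scales A K \<Longrightarrow> 0 \<le> r"
  by (simp add: covering_scales_def)

lemma covering_scalesE:
  assumes "r \<in> covering_scales A K"
  obtains x where "\<forall>a\<in>A. \<exists>k\<in>K. a = r *\<^sub>R k + x"
  using assms unfolding covering_scales_def by blast

lemma bdd_below_covering_scales: "bdd_below (covering_scales A K)"
  using covering_scales_nonneg by (rule bdd_belowI)

text \<open>\<open>K\<close> contains a ball of radius \<open>e\<close> about some \<open>c\<close>,
  and \<open>A\<close> lies in a ball of radius \<open>B\<close> about the origin. Scaling by
  \<open>B / e\<close> and moving the image of \<open>c\<close> to the origin therefore covers
  \<open>A\<close>. Without such a scale, the infimum would be taken over the empty set and would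
  carry no information.\<close>

lemma covering_scales_nonempty:
  assumes "interior K \<noteq> {}" "bounded A"
  shows "covering_scales A K \<noteq> {}"
proof -
  obtain c e where e: "e > 0" "ball c e \<subseteq> K"
    using assms(1) mem_interior by blast
  obtain B where B: "B > 0" "\<And>a. a \<in> A \<Longrightarrow> norm a < B"
    using assms(2) unfolding bounded_pos_less by blast
  define r where "r = B / e"
  have r: "r > 0" using e B by (simp add: r_def)
  have "A \<subseteq> (\<lambda>k. r *\<^sub>R k + (- (r *\<^sub>R c))) ` K"
  proof
    fix a assume "a \<in> A"
    then have "norm a / r < e"
      using B r e by (simp add: r_def field_simps)
    \<comment> \<open>This is the preimage of \<open>a\<close> under the scaling and translation;
      its distance from \<open>c\<close> is \<open>norm a / r\<close>.\<close>
    then have "c + a /\<^sub>R r \<in> K"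
      using r e(2) by (auto simp: subset_iff dist_norm field_simps)
    moreover have "a = r *\<^sub>R (c + a /\<^sub>R r) + (- (r *\<^sub>R c))"
      using r by (simp add: scaleR_add_right)
    ultimately show "a \<in> (\<lambda>k. r *\<^sub>R k + (- (r *\<^sub>R c))) ` K" by blast
  qed
  then have "r \<in> covering_scales A K"
    using r unfolding covering_scales_def by (blast intro: less_imp_le)
  then show ?thesis by blast
qed

lemma circumradius_nonneg:
  assumes "interior K \<noteq> {}" "bounded A"
  shows "0 \<le> circumradius A K"
  unfolding circumradius_eq_Inf
  using covering_scales_nonempty[OF assms] covering_scales_nonneg by (rule cInf_greatest)

text \<open>Scale 0 collapses the nonempty set \<open>K\<close> to a point, which the translation
  moves to \<open>a\<close>. The inclusion in \<open>{a}\<close> treats the empty set together with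
  singletons.\<close>

lemma circumradius_subset_singleton:
  assumes "interior K \<noteq> {}" "A \<subseteq> {a}"
  shows "circumradius A K = 0"
proof (rule antisym)
  have "K \<noteq> {}"
    using assms(1) by auto
  then have "0 \<in> covering_scales A K"
    using assms(2) by (auto simp: covering_scales_def)
  then show "circumradius A K \<le> 0"
    unfolding circumradius_eq_Inf by (rule cInf_lower[OF _ bdd_below_covering_scales])
  show "0 \<le> circumradius A K"
    using assms(1) bounded_subset[OF _ assms(2)] by (intro circumradius_nonneg) auto
qed

text \<open>A copy of \<open>K\<close> at scale \<open>r\<close> has diameter at most
  \<open>r * M\<close>, so two distinct points of \<open>A\<close> keep every covering scale above
  one fixed positive number, and the infimum stays above it too.\<close>

lemma circumradius_pos:
  assumes "bounded K" "interior K \<noteq> {}" "bounded A" "a \<in> A" "b \<in> A" "a \<noteq> b"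
  shows "0 < circumradius A K"
proof -
  obtain N where N: "\<And>k l. k \<in> K \<Longrightarrow> l \<in> K \<Longrightarrow> dist k l \<le> N"
    using assms(1) unfolding bounded_two_points by blast
  \<comment> \<open>The maximum with 1 provides a positive bound on distances in \<open>K\<close>,
    so that division by it is safe.\<close>
  define M where "M = max N 1"
  have M: "M > 0" "\<And>k l. k \<in> K \<Longrightarrow> l \<in> K \<Longrightarrow> dist k l \<le> M"
    using N by (auto simp: M_def le_max_iff_disj)
  have "dist a b / M \<le> r" if r: "r \<in> covering_scales A K" for r
  proof -
    obtain x where x: "\<forall>c\<in>A. \<exists>k\<in>K. c = r *\<^sub>R k + x"
      using r by (rule covering_scalesE)
    obtain k l where kl: "k \<in> K" "a = r *\<^sub>R k + x" "l \<in> K" "b = r *\<^sub>R l + x"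
      using x assms(4,5) by meson
    have "dist a b = r * dist k l"
      using kl covering_scales_nonneg[OF r] by (simp add: dist_norm flip: scaleR_diff_right)
    also have "\<dots> \<le> r * M"
      using M kl covering_scales_nonneg[OF r] by (simp add: mult_left_mono)
    finally show ?thesis
      using M by (simp add: field_simps)
  qed
  then have "dist a b / M \<le> circumradius A K"
    unfolding circumradius_eq_Inf
    by (intro cInf_greatest covering_scales_nonempty assms) auto
  moreover have "0 < dist a b / M"
    using M assms(6) by simp
  ultimately show ?thesis by linarith
qed

text \<open>Dividing by \<open>r + s\<close> gives a convex combination of \<open>k\<close> and
  \<open>l\<close>. If \<open>r + s = 0\<close>, both scales vanish and any point of
  \<open>K\<close> serves as \<open>m\<close>.\<close>

lemma convex_scaled_sum:
  assumes "convex K" "k \<in> K" "l \<in> K" "0 \<le> r" "0 \<le> s"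
  shows "\<exists>m\<in>K. r *\<^sub>R k + s *\<^sub>R l = (r + s) *\<^sub>R m"
proof (cases "r + s = 0")
  case True
  then have "r = 0" "s = 0" using assms by auto
  then show ?thesis using assms by auto
next
  case False
  have "(r / (r + s)) *\<^sub>R k + (s / (r + s)) *\<^sub>R l \<in> K"
    using assms False by (intro convexD) (auto simp: add_divide_distrib[symmetric])
  moreover have "r *\<^sub>R k + s *\<^sub>R l = (r + s) *\<^sub>R ((r / (r + s)) *\<^sub>R k + (s / (r + s)) *\<^sub>R l)"
    using False by (simp add: scaleR_add_right)
  ultimately show ?thesis by blast
qed

lemma covering_scales_add:
  assumes "convex K" "b \<in> B"
    and r: "r \<in> covering_scales (A \<union> B) K" and s: "s \<in> covering_scales (B \<union> C) K"
  shows "r + s \<in> covering_scales (A \<union> C) K"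
proof -
  have nn: "0 \<le> r" "0 \<le> s" using r s covering_scales_nonneg by auto
  obtain x where x: "\<forall>a\<in>A \<union> B. \<exists>k\<in>K. a = r *\<^sub>R k + x"
    using r by (rule covering_scalesE)
  obtain y where y: "\<forall>a\<in>B \<union> C. \<exists>k\<in>K. a = s *\<^sub>R k + y"
    using s by (rule covering_scalesE)
  obtain k where k: "k \<in> K" "b = r *\<^sub>R k + x"
    using x assms(2) by blast
  obtain l where l: "l \<in> K" "b = s *\<^sub>R l + y"
    using y assms(2) by blast
  \<comment> \<open>The two representations of \<open>b\<close> make this offset symmetric:
    \<open>x\<close> is \<open>z\<close> plus a point of \<open>s K\<close>, and \<open>y\<close> is
    \<open>z\<close> plus a point of \<open>r K\<close>. Each point of \<open>A\<close> or
    \<open>C\<close> then becomes \<open>z\<close> plus a point of \<open>r K + s K\<close>.\<close>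
  define z where "z = b - r *\<^sub>R k - s *\<^sub>R l"
  have xz: "x = s *\<^sub>R l + z" using k by (simp add: z_def)
  have yz: "y = r *\<^sub>R k + z" using l by (simp add: z_def)
  have "\<exists>m\<in>K. a = (r + s) *\<^sub>R m + z" if "a \<in> A \<union> C" for a
    using that
  proof
    assume "a \<in> A"
    then obtain p where p: "p \<in> K" "a = r *\<^sub>R p + x" using x by blast
    then have "a = (r *\<^sub>R p + s *\<^sub>R l) + z" by (simp add: xz)
    then show ?thesis
      using convex_scaled_sum[OF assms(1) p(1) l(1) nn] by metis
  next
    assume "a \<in> C"
    then obtain p where p: "p \<in> K" "a = s *\<^sub>R p + y" using y by blast
    then have "a = (r *\<^sub>R k + s *\<^sub>R p) + z" by (simp add: yz)
    then show ?thesis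
      using convex_scaled_sum[OF assms(1) k(1) p(1) nn] by metis
  qed
  then show ?thesis
    using nn unfolding covering_scales_def by (auto simp: image_iff subset_iff)
qed

lemma circumradius_triangle:
  assumes "convex K" "interior K \<noteq> {}" "bounded A" "bounded B" "bounded C" "B \<noteq> {}"
  shows "circumradius (A \<union> C) K \<le> circumradius (A \<union> B) K + circumradius (B \<union> C) K"
proof -
  obtain b where b: "b \<in> B" using assms(6) by blast
  have sum: "circumradius (A \<union> C) K \<le> r + s"
    if "r \<in> covering_scales (A \<union> B) K" "s \<in> covering_scales (B \<union> C) K" for r s
    unfolding circumradius_eq_Inf
    using covering_scales_add[OF assms(1) b that] bdd_below_covering_scales by (rule cInf_lower)
  \<comment> \<open>The infima are taken one at a time: first over \<open>r\<close> with
    \<open>s\<close> fixed, then over \<open>s\<close>. Instantiating the unfolding leaves the other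
    circumradii folded.\<close>
  have "circumradius (A \<union> C) K - s \<le> circumradius (A \<union> B) K"
    if "s \<in> covering_scales (B \<union> C) K" for s
    unfolding circumradius_eq_Inf[of "A \<union> B"]
    using sum[OF _ that] assms
    by (intro cInf_greatest covering_scales_nonempty) (auto simp: diff_le_eq)
  then have "circumradius (A \<union> C) K - circumradius (A \<union> B) K \<le> circumradius (B \<union> C) K"
    unfolding circumradius_eq_Inf[of "B \<union> C"]
    using assms by (intro cInf_greatest covering_scales_nonempty) (auto simp: algebra_simps)
  then show ?thesis by simp
qed

theorem theorem5:
  fixes K :: "(real ^ 'd) set"
  assumes "convex_body K"
  shows "diversity (UNIV :: (real ^ 'd) set) (\<lambda>A. circumradius A K)"
proof -
  have K: "bounded K" "convex K" "interior K \<noteq> {}"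
    using assms by (auto simp: convex_body_def compact_imp_bounded)
  \<comment> \<open>Finiteness gives boundedness and makes \<open>card\<close> meaningful, since an
    infinite set has \<open>card\<close> 0.\<close>
  have "circumradius A K = 0 \<longleftrightarrow> card A \<le> 1" if "finite A" for A
  proof
    assume "circumradius A K = 0"
    then have "\<forall>a\<in>A. \<forall>b\<in>A. a = b"
      using circumradius_pos[OF K(1,3) finite_imp_bounded[OF that]] by (metis less_irrefl)
    then show "card A \<le> 1"
      using card_le_Suc0_iff_eq[OF that] by simp
  next
    assume "card A \<le> 1"
    then have "\<forall>a\<in>A. \<forall>b\<in>A. a = b"
      using card_le_Suc0_iff_eq[OF that] by simp
    then obtain a where "A \<subseteq> {a}" by blast
    then show "circumradius A K = 0"
      by (rule circumradius_subset_singleton[OF K(3)])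
  qed
  then show ?thesis
    unfolding diversity_def
    by (intro conjI allI impI circumradius_nonneg circumradius_triangle K)
      (auto intro: finite_imp_bounded)
qed

end
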